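(* Let $\pi$ be a Desarguesian plane of incidence. The following two statements about $\pi$ are equivalent. (Fundamental theorem of projectivities) If $\phi$ and $\psi$ are two projectivities from (the set of points of) a line $a$ to (the set of points of) a line $b$ of $\pi$ and there are three distinct points of $a$ at which $\phi$ and $\psi$ agree, then $\phi=\psi$. (Fundamental theorem of central-axial collinearities) Four points in general position and their images determine a projective mapping of the plane: if $A,B,C,D$ are four points of $\pi$ no three of which are collinear, and $A',B',C',D'$ are four points of $\pi$ no three of which are collinear, then there is exactly one projective mapping $\Phi$ of $\pi$ to itself with $\Phi(A)=A'$, $\Phi(B)=B'$, $\Phi(C)=C'$, $\Phi(D)=D'$.
   Context: A plane of incidence consists of points and lines with an incidence relation such that: (P1) two distinct points uniquely determine a line incident with them; (P2) two distinct lines uniquely determine a point incident with them; (P3) there exist four points, no three of which are collinear (incident with one line). The plane is Desarguesian if Desargues's theorem holds in it: whenever $A,B,C$ and $A',B',C'$ are two non-collinear triples of points with $A\ne A'$, $B\ne B'$, $C\ne C'$ and $AB\ne A'B'$, $BC\ne B'C'$, $AC\ne A'C'$, the lines $AA',BB',CC'$ pass through a common point if and only if the points $AB\cap A'B'$, $BC\cap B'C'$, $AC\cap A'C'$ are incident with a common line. Given two lines $a$ and $b$ of the plane and a point $P$ on neither line, the central perspectivity from $a$ to $b$ with center $P$ is the bijection from the points of $a$ to the points of $b$ sending a point $Q$ of $a$ to the intersection point of the line $PQ$ with $b$. A projectivity is a finite product (composition) of central perspectivities; its initial and final lines may coincide. A collinearity of the plane is a bijective mapping of its points to themselves such that the image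 of every line is a line. It is central if there is a point (center) such that every line through this point is mapped to itself, and axial if there is a line (axis) such that every point of this line is mapped to itself. A central-axial collinearity is a collinearity that is central and axial (a collinearity is central if and only if it is axial). A projective mapping of the plane to itself is a finite product (composition) of central-axial collinearities. *)

theory Defs
  imports "HOL-Library.FuncSet"
begin

text \<open>
  A plane is given by a type \<open>'p\<close> of points, a type \<open>'l\<close> of lines and an incidence relation
  \<open>inc\<close>. A map between the point sets of two lines is represented extensionally, i.e. it is
  \<open>undefined\<close> off its initial line, so that equality of such maps is HOL equality.
\<close>

definition points_on :: "('p \<Rightarrow> 'l \<Rightarrow> bool) \<Rightarrow> 'l \<Rightarrow> 'p set" where
  "points_on inc l = {P. inc P l}"

definition collinear :: "('p \<Rightarrow> 'l \<Rightarrow> bool) \<Rightarrow> 'p \<Rightarrow> 'p \<Rightarrow> 'p \<Rightarrow> bool" where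
  "collinear inc A B C \<longleftrightarrow> (\<exists>l. inc A l \<and> inc B l \<and> inc C l)"

definition general_position :: "('p \<Rightarrow> 'l \<Rightarrow> bool) \<Rightarrow> 'p \<Rightarrow> 'p \<Rightarrow> 'p \<Rightarrow> 'p \<Rightarrow> bool" where
  "general_position inc A B C D \<longleftrightarrow>
     distinct [A, B, C, D] \<and>
     \<not> collinear inc A B C \<and> \<not> collinear inc A B D \<and>
     \<not> collinear inc A C D \<and> \<not> collinear inc B C D"

text \<open>The join is meaningful only for distinct points, the meet only for distinct lines.\<close>

definition join :: "('p \<Rightarrow> 'l \<Rightarrow> bool) \<Rightarrow> 'p \<Rightarrow> 'p \<Rightarrow> 'l" where
  "join inc A B = (THE l. inc A l \<and> inc B l)"

definition meet :: "('p \<Rightarrow> 'l \<Rightarrow> bool) \<Rightarrow> 'l \<Rightarrow> 'l \<Rightarrow> 'p" where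
  "meet inc a b = (THE P. inc P a \<and> inc P b)"

locale incidence_plane =
  fixes inc :: "'p \<Rightarrow> 'l \<Rightarrow> bool"
  assumes P1: "A \<noteq> B \<Longrightarrow> \<exists>!l. inc A l \<and> inc B l"
    and P2: "a \<noteq> b \<Longrightarrow> \<exists>!P. inc P a \<and> inc P b"
    and P3: "\<exists>A B C D. general_position inc A B C D"

locale desarguesian_plane = incidence_plane inc
  for inc :: "'p \<Rightarrow> 'l \<Rightarrow> bool" +
  assumes desargues:
    "\<lbrakk> \<not> collinear inc A B C; \<not> collinear inc A' B' C';
       A \<noteq> A'; B \<noteq> B'; C \<noteq> C';
       join inc A B \<noteq> join inc A' B'; join inc B C \<noteq> join inc B' C';
       join inc A C \<noteq> join inc A' C' \<rbrakk> \<Longrightarrow>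
     (\<exists>P. inc P (join inc A A') \<and> inc P (join inc B B') \<and> inc P (join inc C C')) \<longleftrightarrow>
     collinear inc (meet inc (join inc A B) (join inc A' B'))
                   (meet inc (join inc B C) (join inc B' C'))
                   (meet inc (join inc A C) (join inc A' C'))"

definition perspectivity :: "('p \<Rightarrow> 'l \<Rightarrow> bool) \<Rightarrow> 'l \<Rightarrow> 'l \<Rightarrow> ('p \<Rightarrow> 'p) \<Rightarrow> bool" where
  "perspectivity inc a b f \<longleftrightarrow>
     (\<exists>P. \<not> inc P a \<and> \<not> inc P b \<and>
          f = restrict (\<lambda>Q. meet inc (join inc P Q) b) (points_on inc a))"

inductive projectivity :: "('p \<Rightarrow> 'l \<Rightarrow> bool) \<Rightarrow> 'l \<Rightarrow> 'l \<Rightarrow> ('p \<Rightarrow> 'p) \<Rightarrow> bool"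
  for inc :: "'p \<Rightarrow> 'l \<Rightarrow> bool" where
  single: "perspectivity inc a b f \<Longrightarrow> projectivity inc a b f"
| comp: "projectivity inc a b f \<Longrightarrow> perspectivity inc b c g \<Longrightarrow>
         projectivity inc a c (compose (points_on inc a) g f)"

definition collineation :: "('p \<Rightarrow> 'l \<Rightarrow> bool) \<Rightarrow> ('p \<Rightarrow> 'p) \<Rightarrow> bool" where
  "collineation inc f \<longleftrightarrow> bij f \<and> (\<forall>l. \<exists>m. f ` points_on inc l = points_on inc m)"

definition central :: "('p \<Rightarrow> 'l \<Rightarrow> bool) \<Rightarrow> ('p \<Rightarrow> 'p) \<Rightarrow> bool" where
  "central inc f \<longleftrightarrow> (\<exists>Z. \<forall>l. inc Z l \<longrightarrow> f ` points_on inc l = points_on inc l)"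

definition axial :: "('p \<Rightarrow> 'l \<Rightarrow> bool) \<Rightarrow> ('p \<Rightarrow> 'p) \<Rightarrow> bool" where
  "axial inc f \<longleftrightarrow> (\<exists>l. \<forall>P. inc P l \<longrightarrow> f P = P)"

definition central_axial_collineation :: "('p \<Rightarrow> 'l \<Rightarrow> bool) \<Rightarrow> ('p \<Rightarrow> 'p) \<Rightarrow> bool" where
  "central_axial_collineation inc f \<longleftrightarrow> collineation inc f \<and> central inc f \<and> axial inc f"

inductive projective_mapping :: "('p \<Rightarrow> 'l \<Rightarrow> bool) \<Rightarrow> ('p \<Rightarrow> 'p) \<Rightarrow> bool"
  for inc :: "'p \<Rightarrow> 'l \<Rightarrow> bool" where
  single: "central_axial_collineation inc f \<Longrightarrow> projective_mapping inc f"
| comp: "projective_mapping inc f \<Longrightarrow> central_axial_collineation inc g \<Longrightarrow>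
         projective_mapping inc (g \<circ> f)"

end

(*
  By Desargues's theorem there is, for every center Z, axis l and admissible pair A, A', a
  central-axial collineation with this center and axis that maps A to A'.

  Every perspectivity is therefore the restriction of a central-axial collineation, and every
  projectivity the restriction of a projective mapping.  If two projectivities agree at three points
  P, Q, R of a, the quotient of their extensions fixes these points.  Composing it with collineations
  of axis a changes nothing on a and makes it fix also two further points X, Y on a line through R;
  as P, Q, X, Y are in general position, the result is the identity.

  Conversely, a projective mapping restricted to a line is a projectivity.  If it fixes A, B, C, D in
  general position, then it fixes on each side of the triangle ABC the two vertices and the
  intersection with the opposite line through D, hence, by the fundamental theorem of
  projectivities, all points of the three sides, hence all points.  Existence of a projective mapping
  between two quadruples needs no such hypothesis: the points are moved one at a time.
*)
theory Submission
  imports Defs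
begin

section \<open>Elementary incidence geometry: points and lines that avoid given ones\<close>

context incidence_plane
begin

lemma line_unique: "A \<noteq> B \<Longrightarrow> inc A l \<Longrightarrow> inc B l \<Longrightarrow> inc A m \<Longrightarrow> inc B m \<Longrightarrow> l = m"
  using P1 by blast

lemma point_unique: "a \<noteq> b \<Longrightarrow> inc P a \<Longrightarrow> inc P b \<Longrightarrow> inc Q a \<Longrightarrow> inc Q b \<Longrightarrow> P = Q"
  using P2 by blast

text \<open>Without a distinctness hypothesis, later proofs can draw lines, and dually intersect
  them by \<open>ex_point\<close>, before it is known which points or lines coincide.\<close>

lemma ex_line: "\<exists>l. inc A l \<and> inc B l"
proof (cases "A = B")
  case True
  obtain C D where "C \<noteq> (D :: 'p)"
    using P3 unfolding general_position_def by auto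
  then obtain E where "E \<noteq> A" by metis
  then show ?thesis using P1[of A E] True by blast
qed (use P1 in blast)

lemma ex_point: "\<exists>P. inc P a \<and> inc P b"
proof (cases "a = b")
  case True
  obtain A B C D where g: "general_position inc A B C D"
    using P3 by blast
  have "\<exists>m. m \<noteq> a"
  proof (rule ccontr)
    assume "\<not> (\<exists>m. m \<noteq> a)"
    then have "inc X a" for X
      using ex_line by metis
    then show False
      using g unfolding general_position_def collinear_def by blast
  qed
  then obtain m where "a \<noteq> m"
    by metis
  then show ?thesis using P2[of a m] True by blast
qed (use P2 in blast)

lemma join_eq: "A \<noteq> B \<Longrightarrow> inc A l \<Longrightarrow> inc B l \<Longrightarrow> join inc A B = l"
  unfolding join_def using line_unique by blast

lemma meet_eq: "a \<noteq> b \<Longrightarrow> inc P a \<Longrightarrow> inc P b \<Longrightarrow> meet inc a b = P"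
  unfolding meet_def using point_unique by blast

lemma not_collinearD:
  assumes "\<not> collinear inc A B C"
  shows "A \<noteq> B" "A \<noteq> C" "B \<noteq> C"
  using assms ex_line unfolding collinear_def by metis+

lemma collinear_iff:
  "A \<noteq> B \<Longrightarrow> inc A l \<Longrightarrow> inc B l \<Longrightarrow> collinear inc A B C \<longleftrightarrow> inc C l"
  unfolding collinear_def using line_unique by blast

text \<open>Each of four points in general position sees the other three along distinct lines, and
  \<open>l\<close> cannot pass through all of \<open>A\<close>, \<open>B\<close>,
  \<open>C\<close>.\<close>

lemma three_lines_off:
  "\<exists>P a b c. \<not> inc P l \<and> inc P a \<and> inc P b \<and> inc P c \<and> distinct [a, b, c]"
proof -
  have pencil: "\<exists>a b c. inc P a \<and> inc P b \<and> inc P c \<and> distinct [a, b, c]"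
    if "general_position inc P B C D" for P B C D
  proof -
    obtain a b c where "inc P a" "inc B a" "inc P b" "inc C b" "inc P c" "inc D c"
      using ex_line by metis
    moreover from this have "distinct [a, b, c]"
      using that by (auto simp: general_position_def collinear_def)
    ultimately show ?thesis by blast
  qed
  obtain A B C D where g: "general_position inc A B C D"
    using P3 by blast
  have "general_position inc B A C D" "general_position inc C A B D"
    using g by (auto simp: general_position_def collinear_def)
  moreover have "\<not> inc A l \<or> \<not> inc B l \<or> \<not> inc C l"
    using g by (auto simp: general_position_def collinear_def)
  ultimately show ?thesis
    using g pencil by metis
qed

lemma section_distinct:
  assumes "\<not> inc V q" "inc V a" "inc V b" "a \<noteq> b" "inc X a" "inc X q" "inc Y b" "inc Y q"
  shows "X \<noteq> Y"
  using assms line_unique by metis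

text \<open>Intersect \<open>l\<close> with three lines of a pencil whose vertex is off
  \<open>l\<close>.\<close>

lemma three_points:
  "\<exists>A B C. inc A l \<and> inc B l \<and> inc C l \<and> distinct [A, B, C]"
proof -
  obtain P a b c where P: "\<not> inc P l" "inc P a" "inc P b" "inc P c" "distinct [a, b, c]"
    using three_lines_off by blast
  obtain A B C where "inc A a" "inc A l" "inc B b" "inc B l" "inc C c" "inc C l"
    using ex_point by metis
  moreover from this have "distinct [A, B, C]"
    using P by (auto dest: section_distinct)
  ultimately show ?thesis by blast
qed

lemma ex_point_on: "\<exists>X. inc X l \<and> X \<noteq> P \<and> X \<noteq> Q"
proof -
  obtain A B C where "inc A l" "inc B l" "inc C l" "distinct [A, B, C]"
    using three_points by blast
  then show ?thesis by (cases "A = P \<or> A = Q"; cases "B = P \<or> B = Q") auto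
qed

lemma ex_line_off: "\<exists>l. \<not> inc Z l"
  using three_lines_off point_unique P3 ex_line
  unfolding general_position_def collinear_def by metis

text \<open>Dual to \<open>ex_point_on\<close>: \<open>Z\<close> is joined to a point
  \<open>X\<close> of a line \<open>q\<close> missing \<open>Z\<close>, where \<open>X\<close>
  avoids one intersection of \<open>q\<close> with each of \<open>m\<close> and
  \<open>n\<close>.\<close>

lemma ex_line_through: "\<exists>l. inc Z l \<and> l \<noteq> m \<and> l \<noteq> n"
proof -
  obtain q where q: "\<not> inc Z q"
    using ex_line_off by blast
  obtain P Q where P: "inc P m" "inc P q" and Q: "inc Q n" "inc Q q"
    using ex_point by metis
  obtain X where X: "inc X q" "X \<noteq> P" "X \<noteq> Q"
    using ex_point_on by blast
  obtain l where l: "inc Z l" "inc X l"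
    using ex_line by blast
  have "l \<noteq> m" "l \<noteq> n"
    using l q X P Q line_unique by metis+
  then show ?thesis using l by blast
qed

lemma ex_point_off_two: "\<exists>P. \<not> inc P a \<and> \<not> inc P b"
proof -
  obtain R where R: "inc R a" "inc R b"
    using ex_point by blast
  obtain l where l: "inc R l" "l \<noteq> a" "l \<noteq> b"
    using ex_line_through by blast
  obtain P where "inc P l" "P \<noteq> R"
    using ex_point_on by blast
  then show ?thesis using l R line_unique by metis
qed

lemma ex_line_through_off_two:
  assumes "R \<noteq> A" "R \<noteq> B"
  shows "\<exists>l. inc R l \<and> \<not> inc A l \<and> \<not> inc B l"
proof -
  obtain m n where "inc R m" "inc A m" "inc R n" "inc B n"
    using ex_line by metis
  moreover obtain l where "inc R l" "l \<noteq> m" "l \<noteq> n"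
    using ex_line_through by blast
  ultimately show ?thesis using assms line_unique by metis
qed

lemma ex_line_off_two: "\<exists>l. \<not> inc A l \<and> \<not> inc B l"
proof -
  obtain q where "inc A q" "inc B q"
    using ex_line by blast
  obtain R where "R \<noteq> A" "R \<noteq> B"
    using ex_point_on by blast
  then show ?thesis using ex_line_through_off_two by blast
qed

text \<open>Projection from a point \<open>V\<close> off both lines carries the points of
  \<open>m\<close> injectively to those of \<open>q\<close>, so a fourth point on one line yields a
  fourth point on every line. The points \<open>P'\<close>, \<open>Q'\<close>, \<open>R'\<close> of
  \<open>m\<close> are the ones whose projections could be \<open>P\<close>, \<open>Q\<close>,
  \<open>R\<close>.\<close>

lemma ex_fourth_point_on:
  assumes m: "inc A m" "inc B m" "inc C m" "inc D m" "distinct [A, B, C, D]"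
  shows "\<exists>X. inc X q \<and> X \<noteq> P \<and> X \<noteq> Q \<and> X \<noteq> R"
proof -
  obtain V where V: "\<not> inc V m" "\<not> inc V q"
    using ex_point_off_two by blast
  obtain p a b where lines: "inc V p" "inc P p" "inc V a" "inc Q a" "inc V b" "inc R b"
    using ex_line by metis
  obtain P' Q' R' where proj: "inc P' p" "inc P' m" "inc Q' a" "inc Q' m" "inc R' b" "inc R' m"
    using ex_point by metis
  have "\<not> {A, B, C, D} \<subseteq> {P', Q', R'}"
  proof
    assume "{A, B, C, D} \<subseteq> {P', Q', R'}"
    then have "card {A, B, C, D} \<le> card {P', Q', R'}"
      by (simp add: card_mono)
    also have "\<dots> \<le> 3"
      by (simp add: card_insert_if)
    finally show False
      using m(5) by simp
  qed
  then obtain W where W: "inc W m" "W \<noteq> P'" "W \<noteq> Q'" "W \<noteq> R'"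
    using m by blast
  obtain w where w: "inc V w" "inc W w"
    using ex_line by blast
  obtain X where X: "inc X w" "inc X q"
    using ex_point by blast
  have "w \<noteq> p" "w \<noteq> a" "w \<noteq> b"
    using W w V(1) proj point_unique by metis+
  then have "X \<noteq> P" "X \<noteq> Q" "X \<noteq> R"
    using X w V(2) lines line_unique by metis+
  then show ?thesis using X by blast
qed

text \<open>The point is sought on a second line \<open>q\<close> through \<open>A\<close>. This
  line differs from \<open>l\<close>, \<open>m\<close> and \<open>n\<close>, so only three of its
  points are forbidden, and the four points on \<open>m\<close> guarantee a fourth one on
  \<open>q\<close>.\<close>

lemma ex_point_off_three:
  assumes m: "inc Z m" "inc A m" "inc B m" "inc C m" "distinct [Z, A, B, C]"
    and A: "\<not> inc A l" "\<not> inc A n"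
  shows "\<exists>X. \<not> inc X l \<and> \<not> inc X m \<and> \<not> inc X n"
proof -
  obtain q where q: "inc A q" "q \<noteq> m"
    using ex_line_through by blast
  obtain P Q R where "inc P q" "inc P l" "inc Q q" "inc Q m" "inc R q" "inc R n"
    using ex_point by metis
  moreover obtain X where "inc X q" "X \<noteq> P" "X \<noteq> Q" "X \<noteq> R"
    using ex_fourth_point_on m by metis
  ultimately show ?thesis using q A point_unique by metis
qed

section \<open>Collineations with given center and axis\<close>

text \<open>
  \<open>mates\<close> lists the necessary conditions on a point off the axis \<open>l\<close> and its image under a nontrivial
  collineation with center \<open>Z\<close> and axis \<open>l\<close>; \<open>linked\<close> says that the lines \<open>XY\<close>, \<open>X'Y'\<close> and \<open>l\<close> concur.
  No relation between \<open>Z\<close> and \<open>l\<close> is assumed, so elations and homologies are treated together.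
\<close>

definition mates :: "'p \<Rightarrow> 'l \<Rightarrow> 'p \<Rightarrow> 'p \<Rightarrow> bool" where
  "mates Z l X X' \<longleftrightarrow>
     X \<noteq> X' \<and> X \<noteq> Z \<and> X' \<noteq> Z \<and> \<not> inc X l \<and> \<not> inc X' l \<and> collinear inc Z X X'"

definition linked :: "'l \<Rightarrow> 'p \<Rightarrow> 'p \<Rightarrow> 'p \<Rightarrow> 'p \<Rightarrow> bool" where
  "linked l X X' Y Y' \<longleftrightarrow> (\<exists>S. inc S l \<and> collinear inc X Y S \<and> collinear inc X' Y' S)"

lemma collinear_rotate: "collinear inc A B C \<longleftrightarrow> collinear inc B C A"
  unfolding collinear_def by blast

lemma collinear_swap: "collinear inc A B C \<longleftrightarrow> collinear inc A C B"
  unfolding collinear_def by blast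

lemma mates_sym: "mates Z l X X' \<longleftrightarrow> mates Z l X' X"
  unfolding mates_def collinear_def by blast

lemma linked_swap: "linked l X X' Y Y' \<longleftrightarrow> linked l Y Y' X X'"
  unfolding linked_def collinear_def by blast

lemma linked_inverse: "linked l X X' Y Y' \<longleftrightarrow> linked l X' X Y' Y"
  unfolding linked_def by blast

lemma collinear_mates:
  assumes "mates Z l X X'"
  shows "collinear inc Z X Y \<longleftrightarrow> collinear inc Z X' Y"
  using assms line_unique unfolding mates_def collinear_def by metis

text \<open>The classical construction: if \<open>AX\<close> meets the axis in \<open>S\<close>,
  then \<open>X'\<close> can only be the intersection of \<open>ZX\<close> with
  \<open>A'S\<close>.\<close>

lemma ex1_mate:
  assumes A: "mates Z l A A'" and X: "\<not> inc X l" "\<not> collinear inc Z A X"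
  shows "\<exists>!X'. mates Z l X X' \<and> linked l A A' X X'"
proof -
  obtain m where m: "inc Z m" "inc A m" "inc A' m"
    using A unfolding mates_def collinear_def by blast
  have Xm: "\<not> inc X m"
    using m X unfolding collinear_def by blast
  obtain n a where n: "inc Z n" "inc X n" and a: "inc A a" "inc X a"
    using ex_line by metis
  obtain S where S: "inc S a" "inc S l"
    using ex_point by metis
  obtain b where b: "inc A' b" "inc S b"
    using ex_line by metis
  obtain X' where X': "inc X' n" "inc X' b"
    using ex_point by metis
  have dist: "A \<noteq> A'" "A \<noteq> Z" "A' \<noteq> Z" "\<not> inc A l" "\<not> inc A' l" "n \<noteq> m" "a \<noteq> m" "X \<noteq> Z"
    using A n a m Xm unfolding mates_def by auto
  have Sm: "\<not> inc S m"
    using dist S a m line_unique by metis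
  have b_ne: "b \<noteq> m" "b \<noteq> n" "b \<noteq> l" "b \<noteq> a" "n \<noteq> a"
    using Sm b n dist m X a line_unique by metis+
  have "X' \<noteq> Z"
    using b X' m b_ne dist line_unique by metis
  moreover have "X' \<noteq> X"
    using X b_ne X' S a b point_unique by metis
  moreover have "\<not> inc X' l"
    using X b_ne X' S a b n point_unique by metis
  ultimately have 1: "mates Z l X X' \<and> linked l A A' X X'"
    using X dist n a b X' S unfolding mates_def linked_def collinear_def by blast
  \<comment> \<open>\<open>linked\<close> only asserts that some lines exist; here they are
    identified with the constructed ones, because \<open>A\<close> differs from \<open>X\<close> and
    \<open>A'\<close> is off the axis.\<close>
  have 2: "Y = X'" if Y: "mates Z l X Y" "linked l A A' X Y" for Y
  proof -
    have "inc Y n"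
      using Y(1) n collinear_iff[of Z X n Y] dist unfolding mates_def by simp
    obtain T c d where T: "inc T l" "inc A c" "inc X c" "inc T c" "inc A' d" "inc Y d" "inc T d"
      using Y(2) unfolding linked_def collinear_def by blast
    have "c = a"
      using T a Xm m line_unique by metis
    then have "T = S"
      using T S dist a point_unique by metis
    then have "d = b"
      using T b dist line_unique by metis
    then show "Y = X'"
      using \<open>inc Y n\<close> T X' b_ne point_unique by metis
  qed
  show ?thesis using 1 2 by blast
qed

text \<open>The degenerate case of \<open>linked_trans\<close>, where Desargues's theorem says
  nothing: \<open>AB\<close> and \<open>AC\<close> are one line, which meets the axis in one point
  \<open>S\<close>, so \<open>B'\<close> and \<open>C'\<close> both lie on
  \<open>A'S\<close>.\<close>

lemma linked_trans_collinear:
  assumes A: "mates Z l A A'"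
    and AB: "linked l A A' B B'" and AC: "linked l A A' C C'"
    and ne: "A \<noteq> B" "A \<noteq> C" and col: "collinear inc A B C"
  shows "linked l B B' C C'"
proof -
  obtain S c c' where S: "inc S l" "inc A c" "inc B c" "inc S c" "inc A' c'" "inc B' c'" "inc S c'"
    using AB unfolding linked_def collinear_def by blast
  obtain T b b' where T: "inc T l" "inc A b" "inc C b" "inc T b" "inc A' b'" "inc C' b'" "inc T b'"
    using AC unfolding linked_def collinear_def by blast
  have "inc C c"
    using col collinear_iff ne S by metis
  then have "b = c"
    using S T ne line_unique by metis
  then have "S = T"
    using S T A point_unique unfolding mates_def by metis
  then have "b' = c'"
    using S T A line_unique unfolding mates_def by metis
  then show ?thesis
    using S T \<open>b = c\<close> unfolding linked_def collinear_def by metis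
qed

end

section \<open>Desargues's theorem as transitivity of \<open>linked\<close>\<close>

context desarguesian_plane
begin

text \<open>The direction of \<open>desargues\<close> from center to axis, stated for named lines
  and points so that its applications need not evaluate \<open>join\<close> and
  \<open>meet\<close>.\<close>

lemma desargues_axis:
  assumes "\<not> collinear inc A B C" "\<not> collinear inc A' B' C'" "A \<noteq> A'" "B \<noteq> B'" "C \<noteq> C'"
    and "inc A p" "inc A' p" "inc Z p" "inc B q" "inc B' q" "inc Z q" "inc C r" "inc C' r" "inc Z r"
    and "inc A c" "inc B c" "inc S c" "inc A' c'" "inc B' c'" "inc S c'" "c \<noteq> c'"
    and "inc B a" "inc C a" "inc U a" "inc B' a'" "inc C' a'" "inc U a'" "a \<noteq> a'"
    and "inc A b" "inc C b" "inc T b" "inc A' b'" "inc C' b'" "inc T b'" "b \<noteq> b'"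
  shows "collinear inc S U T"
proof -
  note ne = not_collinearD[OF assms(1)] not_collinearD[OF assms(2)]
  have joins: "join inc A A' = p" "join inc B B' = q" "join inc C C' = r"
    "join inc A B = c" "join inc A' B' = c'" "join inc B C = a" "join inc B' C' = a'"
    "join inc A C = b" "join inc A' C' = b'"
    using assms ne by (auto intro: join_eq)
  moreover have "meet inc c c' = S" "meet inc a a' = U" "meet inc b b' = T"
    using assms by (auto intro: meet_eq)
  ultimately show ?thesis
    using desargues[of A B C A' B' C'] assms by auto
qed

text \<open>The triangles \<open>ABC\<close> and \<open>A'B'C'\<close> are in perspective from
  \<open>Z\<close>. Two pairs of corresponding sides meet in distinct points \<open>S\<close>,
  \<open>T\<close> of \<open>l\<close>, so the Desargues axis is \<open>l\<close>, and it contains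
  the intersection \<open>U\<close> of the third pair.\<close>

lemma linked_trans:
  assumes A: "mates Z l A A'" and B: "mates Z l B B'" and C: "mates Z l C C'"
    and AB: "linked l A A' B B'" and AC: "linked l A A' C C'"
    and n: "\<not> collinear inc Z A B" "\<not> collinear inc Z A C" "\<not> collinear inc Z B C"
  shows "linked l B B' C C'"
proof -
  have n': "\<not> collinear inc Z A' B'" "\<not> collinear inc Z A' C'" "\<not> collinear inc Z B' C'"
    using n collinear_mates A B C collinear_swap by metis+
  note ne = not_collinearD[OF n(1)] not_collinearD[OF n(2)] not_collinearD[OF n(3)]
    not_collinearD[OF n'(1)] not_collinearD[OF n'(2)] not_collinearD[OF n'(3)]
  consider "collinear inc A B C" | "collinear inc A' B' C'"
    | "\<not> collinear inc A B C" "\<not> collinear inc A' B' C'"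
    by blast
  then show ?thesis
  proof cases
    case 1
    then show ?thesis using linked_trans_collinear[OF A AB AC] ne by simp
  next
    \<comment> \<open>The degenerate case again, with the two points of every pair
      exchanged.\<close>
    case 2
    have "linked l B' B C' C"
      using linked_trans_collinear[of Z l A' A B' B C' C] A AB AC ne 2
      by (simp add: mates_sym[of Z l A'] linked_inverse[of l A'])
    then show ?thesis
      by (simp add: linked_inverse[of l B])
  next
    case 3
    obtain p q r where p: "inc A p" "inc A' p" "inc Z p" and q: "inc B q" "inc B' q" "inc Z q"
      and r: "inc C r" "inc C' r" "inc Z r"
      using A B C unfolding mates_def collinear_def by blast
    obtain S c c' where S: "inc S l" "inc A c" "inc B c" "inc S c" "inc A' c'" "inc B' c'" "inc S c'"
      using AB unfolding linked_def collinear_def by blast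
    obtain T b b' where T: "inc T l" "inc A b" "inc C b" "inc T b" "inc A' b'" "inc C' b'" "inc T b'"
      using AC unfolding linked_def collinear_def by blast
    obtain a a' where a: "inc B a" "inc C a" "inc B' a'" "inc C' a'"
      using ex_line by metis
    obtain U where U: "inc U a" "inc U a'"
      using ex_point by metis
    have dist: "A \<noteq> A'" "B \<noteq> B'" "C \<noteq> C'" "\<not> inc A l"
      using A B C unfolding mates_def by auto
    \<comment> \<open>If the two sides coincided, the common line would contain \<open>A\<close> and
      \<open>A'\<close>, hence \<open>Z\<close>, making \<open>Z\<close>, \<open>A\<close>,
      \<open>B\<close> collinear.\<close>
    have "c \<noteq> c'"
      using dist S p n(1) line_unique unfolding collinear_def by metis
    moreover have "b \<noteq> b'"
      using dist T p n(2) line_unique unfolding collinear_def by metis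
    moreover have "a \<noteq> a'"
      using dist a q n(3) line_unique unfolding collinear_def by metis
    ultimately have "collinear inc S U T"
      using desargues_axis[OF 3 dist(1-3) p q r S(2-7) _ a(1,2) U(1) a(3,4) U(2) _ T(2-7)]
      by blast
    moreover have "S \<noteq> T"
      using dist S T 3(1) point_unique unfolding collinear_def by metis
    ultimately have "inc U l"
      using S T collinear_iff collinear_swap by metis
    then show ?thesis
      using a U unfolding linked_def collinear_def by blast
  qed
qed

end

section \<open>The collineation with prescribed center, axis and pair, as a relation\<close>

context incidence_plane
begin

lemma collinear_trans:
  "collinear inc Z A B \<Longrightarrow> A \<noteq> Z \<Longrightarrow> B \<noteq> Z \<Longrightarrow> collinear inc Z A X \<longleftrightarrow> collinear inc Z B X"
  unfolding collinear_def using line_unique by metis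

text \<open>
  The image of a point off the line \<open>ZA\<close> is constructed from the pair \<open>A, A'\<close>; on the line \<open>ZA\<close> this
  construction degenerates and the auxiliary pair \<open>B, B'\<close> takes its place.
\<close>

definition dilation_frame :: "'p \<Rightarrow> 'l \<Rightarrow> 'p \<Rightarrow> 'p \<Rightarrow> 'p \<Rightarrow> 'p \<Rightarrow> bool" where
  "dilation_frame Z l A A' B B' \<longleftrightarrow>
     mates Z l A A' \<and> mates Z l B B' \<and> linked l A A' B B' \<and> \<not> collinear inc Z A B"

definition dilation_graph :: "'p \<Rightarrow> 'l \<Rightarrow> 'p \<Rightarrow> 'p \<Rightarrow> 'p \<Rightarrow> 'p \<Rightarrow> 'p \<Rightarrow> 'p \<Rightarrow> bool" where
  "dilation_graph Z l A A' B B' X X' \<longleftrightarrow>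
     (inc X l \<or> X = Z) \<and> X' = X \<or>
     mates Z l X X' \<and>
       (if collinear inc Z A X then linked l B B' X X' else linked l A A' X X')"

lemma frame_inverse:
  assumes "dilation_frame Z l A A' B B'"
  shows "dilation_frame Z l A' A B' B"
proof -
  have A: "mates Z l A A'" and B: "mates Z l B B'" and n: "\<not> collinear inc Z A B"
    using assms unfolding dilation_frame_def by auto
  have "\<not> collinear inc Z A' B"
    using n collinear_mates[OF A] by blast
  then have "\<not> collinear inc Z A' B'"
    using collinear_mates[OF B] collinear_swap by blast
  then show ?thesis
    using assms mates_sym linked_inverse unfolding dilation_frame_def by blast
qed

text \<open>The converse relation arises from the frame with the two points of each pair exchanged.
  Bijectivity of the resulting map therefore reduces to unique existence of images.\<close>

lemma graph_inverse:
  assumes "dilation_frame Z l A A' B B'" "dilation_graph Z l A A' B B' X X'"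
  shows "dilation_graph Z l A' A B' B X' X"
proof -
  have "collinear inc Z A X \<longleftrightarrow> collinear inc Z A' X'" if "mates Z l X X'"
    using assms(1) that collinear_mates collinear_swap unfolding dilation_frame_def by metis
  then show ?thesis
    using assms(2) mates_sym linked_inverse unfolding dilation_graph_def by metis
qed

lemma graph_ex1:
  assumes f: "dilation_frame Z l A A' B B'"
  shows "\<exists>!X'. dilation_graph Z l A A' B B' X X'"
proof (cases "inc X l \<or> X = Z")
  case True
  then have "\<not> mates Z l X X'" for X'
    unfolding mates_def by blast
  then show ?thesis
    using True unfolding dilation_graph_def by auto
next
  case X: False
  show ?thesis
  proof (cases "collinear inc Z A X")
    case True
    then have "\<not> collinear inc Z B X"
      using X f not_collinearD collinear_trans collinear_swap unfolding dilation_frame_def mates_def by metis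
    then show ?thesis
      using ex1_mate[of Z l B B' X] f X True unfolding dilation_graph_def dilation_frame_def by simp
  next
    case False
    then show ?thesis
      using ex1_mate[of Z l A A' X] f X unfolding dilation_graph_def dilation_frame_def by simp
  qed
qed

lemma graph_collinear: "dilation_graph Z l A A' B B' X X' \<Longrightarrow> collinear inc Z X X'"
  using ex_line[of Z X] unfolding dilation_graph_def mates_def collinear_def by auto

text \<open>A further point \<open>X\<close> gives the line \<open>ZA\<close> the four points
  \<open>Z\<close>, \<open>A\<close>, \<open>A'\<close>, \<open>X\<close> that
  \<open>ex_point_off_three\<close> asks for. Contrapositively, if no such \<open>C\<close> exists,
  then \<open>ZA\<close> has no points other than \<open>Z\<close>, \<open>A\<close>,
  \<open>A'\<close>.\<close>

lemma ex_point_off_axis_and_lines: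
  assumes A: "mates Z l A A'" and n: "\<not> collinear inc Z A B"
    and X: "collinear inc Z A X" "X \<noteq> Z" "X \<noteq> A" "X \<noteq> A'"
  shows "\<exists>C. \<not> inc C l \<and> \<not> collinear inc Z A C \<and> \<not> collinear inc Z B C"
proof -
  obtain m n' where m: "inc Z m" "inc A m" and n': "inc Z n'" "inc B n'"
    using ex_line by metis
  have ne: "A \<noteq> Z" "B \<noteq> Z" "A' \<noteq> Z" "A \<noteq> A'"
    using A not_collinearD[OF n] unfolding mates_def by auto
  have "inc X m" "inc A' m"
    using A X(1) m ne collinear_iff unfolding mates_def by metis+
  moreover have "\<not> inc A n'"
    using n n' unfolding collinear_def by blast
  ultimately obtain C where "\<not> inc C l" "\<not> inc C m" "\<not> inc C n'"
    using ex_point_off_three[of Z m A A' X l n'] m ne X A unfolding mates_def by auto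
  then show ?thesis
    using collinear_iff[OF ne(1)[symmetric] m] collinear_iff[OF ne(2)[symmetric] n'] by blast
qed

end

context desarguesian_plane
begin

text \<open>
  If \<open>Y\<close> is on the line \<open>ZB\<close>, a third pair \<open>C, C'\<close> mediates between the two constructions.  There may
  be no room for \<open>C\<close>, as for elations of the Fano plane, but then \<open>ZA\<close> and \<open>ZB\<close> have no points off
  the axis other than the center and the given pairs.
\<close>

lemma graph_linked_mixed:
  assumes f: "dilation_frame Z l A A' B B'"
    and X: "mates Z l X X'" "collinear inc Z A X" "linked l B B' X X'"
    and Y: "mates Z l Y Y'" "\<not> collinear inc Z A Y" "linked l A A' Y Y'"
  shows "linked l X X' Y Y'"
proof -
  have A: "mates Z l A A'" and B: "mates Z l B B'" and AB: "linked l A A' B B'"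
    and nAB: "\<not> collinear inc Z A B"
    using f unfolding dilation_frame_def by auto
  have ne: "A \<noteq> Z" "B \<noteq> Z" "X \<noteq> Z" "Y \<noteq> Z" "X \<noteq> X'" "Y \<noteq> Y'" "X' \<noteq> Z" "Y' \<noteq> Z"
    using A B X Y unfolding mates_def by auto
  have nX: "\<not> collinear inc Z X C" if "\<not> collinear inc Z A C" for C
    using that X ne collinear_trans by metis
  have nBX: "\<not> collinear inc Z B X"
    using nX[OF nAB] collinear_swap by metis
  show ?thesis
  proof (cases "collinear inc Z B Y")
    \<comment> \<open>\<open>Y\<close> is linked to \<open>B\<close> by way of \<open>A\<close>, and
      then to \<open>X\<close> by way of \<open>B\<close>.\<close>
    case False
    then have "linked l B B' Y Y'"
      using linked_trans[OF A B Y(1) AB Y(3) nAB Y(2)] by blast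
    then show ?thesis
      using linked_trans[OF B X(1) Y(1) X(3)] nBX False nX Y(2) by blast
  next
    case BY: True
    show ?thesis
    proof (cases "\<exists>C. \<not> inc C l \<and> \<not> collinear inc Z A C \<and> \<not> collinear inc Z B C")
      case True
      then obtain C where C: "\<not> inc C l" "\<not> collinear inc Z A C" "\<not> collinear inc Z B C"
        by blast
      obtain C' where C': "mates Z l C C'" "linked l A A' C C'"
        using ex1_mate[OF A C(1,2)] by blast
      have nCX: "\<not> collinear inc Z C X" and nCY: "\<not> collinear inc Z C Y"
        using nX C(2,3) BY ne collinear_trans collinear_swap by metis+
      \<comment> \<open>Four triangles in turn: \<open>A\<close>, \<open>B\<close>, \<open>C\<close>
        links \<open>B\<close> with \<open>C\<close>; \<open>B\<close>, \<open>C\<close>,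
        \<open>X\<close> links \<open>C\<close> with \<open>X\<close>; \<open>A\<close>,
        \<open>C\<close>, \<open>Y\<close> links \<open>C\<close> with \<open>Y\<close>; finally
        \<open>C\<close>, \<open>X\<close>, \<open>Y\<close> links \<open>X\<close> with
        \<open>Y\<close>.\<close>
      have "linked l B B' C C'"
        using linked_trans[OF A B C'(1) AB C'(2) nAB C(2,3)] .
      then have "linked l C C' X X'"
        using linked_trans[OF B C'(1) X(1) _ X(3) C(3) nBX nCX] by blast
      moreover have "linked l C C' Y Y'"
        using linked_trans[OF A C'(1) Y(1) C'(2) Y(3) C(2) Y(2) nCY] .
      ultimately show ?thesis
        using linked_trans[OF C'(1) X(1) Y(1) _ _ nCX nCY nX[OF Y(2)]] by blast
    next
      case False
      have on_m: "W = A \<or> W = A'" if "collinear inc Z A W" "W \<noteq> Z" for W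
        using ex_point_off_axis_and_lines[OF A nAB that] False by blast
      have on_n: "W = B \<or> W = B'" if "collinear inc Z B W" "W \<noteq> Z" for W
        using ex_point_off_axis_and_lines[OF B _ that, of A] False nAB collinear_swap by blast
      have "collinear inc Z A X'" "collinear inc Z B Y'"
        using X Y BY ne collinear_trans unfolding mates_def by metis+
      \<comment> \<open>Both pairs are given ones up to order. If neither or both are reversed, the
        goal is the link of the frame or its inverse; if only one is, the goal is the hypothesis
        about that pair, up to symmetry.\<close>
      then have "(X = A \<and> X' = A' \<or> X = A' \<and> X' = A) \<and> (Y = B \<and> Y' = B' \<or> Y = B' \<and> Y' = B)"
        using on_m on_n X(2) BY ne by metis
      then show ?thesis
        using AB X(3) Y(3) linked_swap linked_inverse by metis
    qed
  qed
qed

text \<open>As \<open>X\<close>, \<open>Y\<close> and \<open>Z\<close> are not collinear, at most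
  one of \<open>X\<close>, \<open>Y\<close> lies on \<open>ZA\<close> and uses the auxiliary pair;
  that case is \<open>graph_linked_mixed\<close>, the other is \<open>linked_trans\<close>.\<close>

lemma graph_linked:
  assumes f: "dilation_frame Z l A A' B B'"
    and X: "dilation_graph Z l A A' B B' X X'" "mates Z l X X'"
    and Y: "dilation_graph Z l A A' B B' Y Y'" "mates Z l Y Y'"
    and n: "\<not> collinear inc Z X Y"
  shows "linked l X X' Y Y'"
proof -
  have ne: "A \<noteq> Z" "X \<noteq> Z" "Y \<noteq> Z" "\<not> inc X l" "\<not> inc Y l"
    using f X Y unfolding dilation_frame_def mates_def by auto
  have A: "mates Z l A A'"
    using f unfolding dilation_frame_def by simp
  have gX: "if collinear inc Z A X then linked l B B' X X' else linked l A A' X X'"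
    and gY: "if collinear inc Z A Y then linked l B B' Y Y' else linked l A A' Y Y'"
    using X Y ne unfolding dilation_graph_def by auto
  show ?thesis
  proof (cases "collinear inc Z A X")
    case True
    moreover from this have "\<not> collinear inc Z A Y"
      using n ne collinear_trans by metis
    ultimately show ?thesis
      using graph_linked_mixed[OF f X(2) _ _ Y(2)] gX gY by simp
  next
    case False
    show ?thesis
    proof (cases "collinear inc Z A Y")
      case True
      then show ?thesis
        using graph_linked_mixed[OF f Y(2) _ _ X(2)] gX gY False linked_swap by metis
    next
      case nY: False
      then show ?thesis
        using linked_trans[OF A X(2) Y(2) _ _ False nY n] gX gY False by simp
    qed
  qed
qed

text \<open>A line \<open>k\<close> that misses \<open>Z\<close> and is not the axis meets the axis
  in one point \<open>S\<close>. A fixed point \<open>X\<close> of \<open>k\<close> is linked with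
  each other point \<open>Y\<close> of \<open>k\<close> off the axis, and the linking point must be
  \<open>S\<close>, so \<open>Y'\<close> lies on \<open>X'S\<close>. Only an inclusion is obtained;
  the inverse frame later supplies equality.\<close>

lemma graph_line:
  assumes f: "dilation_frame Z l A A' B B'"
  shows "\<exists>k'. (\<forall>X X'. inc X k \<and> dilation_graph Z l A A' B B' X X' \<longrightarrow> inc X' k') \<and> (inc Z k \<longrightarrow> k' = k)"
proof -
  consider "inc Z k" | "k = l" "\<not> inc Z k" | "k \<noteq> l" "\<not> inc Z k"
    by blast
  then show ?thesis
  proof cases
    case 1
    have "inc X' k" if "inc X k" "dilation_graph Z l A A' B B' X X'" for X X'
      using graph_collinear[OF that(2)] 1 that collinear_iff[of Z X k X']
      unfolding dilation_graph_def mates_def by metis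
    then show ?thesis using 1 by blast
  next
    case 2
    then have "inc X' k" if "inc X k" "dilation_graph Z l A A' B B' X X'" for X X'
      using that unfolding dilation_graph_def mates_def by blast
    then show ?thesis using 2 by blast
  next
    case 3
    obtain S where S: "inc S k" "inc S l"
      using ex_point by blast
    obtain X where X: "inc X k" "X \<noteq> S"
      using ex_point_on by blast
    have Xl: "\<not> inc X l" "X \<noteq> Z"
      using X S 3 point_unique by metis+
    obtain X' where X': "dilation_graph Z l A A' B B' X X'"
      using graph_ex1[OF f] by blast
    then have mX: "mates Z l X X'"
      using Xl unfolding dilation_graph_def by blast
    obtain k' where k': "inc X' k'" "inc S k'"
      using ex_line by blast
    have "inc Y' k'" if Y: "inc Y k" "dilation_graph Z l A A' B B' Y Y'" for Y Y'
    proof -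
      consider "inc Y l" | "Y = X" | "\<not> inc Y l" "Y \<noteq> X"
        by blast
      then show ?thesis
      proof cases
        case 1
        then have "Y = S"
          using S Y 3 point_unique by metis
        then show ?thesis
          using 1 Y k' unfolding dilation_graph_def mates_def by metis
      next
        case 2
        then show ?thesis
          using Y X' k' graph_ex1[OF f, of X] by metis
      next
        case c: 3
        have "mates Z l Y Y'"
          using c Y 3 unfolding dilation_graph_def by metis
        moreover have "\<not> collinear inc Z X Y"
          using 3 X Y c collinear_iff[of X Y k Z] collinear_rotate by metis
        ultimately obtain T where T: "inc T l" "collinear inc X Y T" "collinear inc X' Y' T"
          using graph_linked[OF f X' mX Y(2)] unfolding linked_def by blast
        then have "inc T k"
          using collinear_iff c X Y by metis
        then have "T = S"
          using T S 3 point_unique by metis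
        moreover have "X' \<noteq> S"
          using mX S unfolding mates_def by metis
        ultimately show ?thesis
          using T k' collinear_iff collinear_swap by metis
      qed
    qed
    then show ?thesis using 3 by blast
  qed
qed

definition with_center_axis :: "'p \<Rightarrow> 'l \<Rightarrow> ('p \<Rightarrow> 'p) \<Rightarrow> bool" where
  "with_center_axis Z l f \<longleftrightarrow> collineation inc f \<and>
     (\<forall>k. inc Z k \<longrightarrow> f ` points_on inc k = points_on inc k) \<and> (\<forall>P. inc P l \<longrightarrow> f P = P)"

text \<open>Any \<open>B\<close> off the axis and off \<open>ZA\<close>, with its mate, completes
  the pair \<open>A\<close>, \<open>A'\<close> to a frame. The graphs of this frame and of its
  inverse are mutually inverse functions \<open>f\<close> and \<open>g\<close> that send lines into
  lines.\<close>

lemma ex_with_center_axis: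
  assumes "A \<noteq> Z" "A' \<noteq> Z" "\<not> inc A l" "\<not> inc A' l" "collinear inc Z A A'"
  shows "\<exists>f. with_center_axis Z l f \<and> f A = A'"
proof (cases "A = A'")
  case True
  have "with_center_axis Z l id"
    unfolding with_center_axis_def collineation_def by auto
  then show ?thesis
    using True by auto
next
  case False
  then have A: "mates Z l A A'"
    using assms unfolding mates_def by simp
  obtain m where m: "inc Z m" "inc A m"
    using ex_line by blast
  obtain B where B: "\<not> inc B l" "\<not> inc B m"
    using ex_point_off_two by blast
  then have nB: "\<not> collinear inc Z A B"
    using m assms collinear_iff by metis
  obtain B' where "mates Z l B B'" "linked l A A' B B'"
    using ex1_mate[OF A B(1) nB] by blast
  then have fr: "dilation_frame Z l A A' B B'"
    using A nB unfolding dilation_frame_def by blast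
  note fr' = frame_inverse[OF fr]
  obtain f where f: "\<And>X. dilation_graph Z l A A' B B' X (f X)"
    using graph_ex1[OF fr] by metis
  obtain g where g: "\<And>X. dilation_graph Z l A' A B' B X (g X)"
    using graph_ex1[OF fr'] by metis
  have gf: "g (f X) = X" for X
    using graph_inverse[OF fr f] g graph_ex1[OF fr'] by metis
  have fg: "f (g X) = X" for X
    using graph_inverse[OF fr' g] f graph_ex1[OF fr] by metis
  have img: "\<exists>k'. f ` points_on inc k = points_on inc k' \<and> (inc Z k \<longrightarrow> k' = k)" for k
  proof -
    obtain k' where k': "\<And>X. inc X k \<Longrightarrow> inc (f X) k'" "inc Z k \<Longrightarrow> k' = k"
      using graph_line[OF fr, of k] f by blast
    obtain k'' where k'': "\<And>X. inc X k' \<Longrightarrow> inc (g X) k''"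
      using graph_line[OF fr', of k'] g by blast
    have "inc X k''" if "inc X k" for X
      using k' k'' gf that by metis
    \<comment> \<open>Going there and back, \<open>k''\<close> contains every point of
      \<open>k\<close>; hence the image of \<open>k\<close> fills \<open>k'\<close>.\<close>
    then have "k'' = k"
      using three_points[of k] line_unique by auto
    then have "f ` points_on inc k = points_on inc k'"
      using k' k'' fg unfolding points_on_def by (auto simp: image_iff) metis
    then show ?thesis
      using k' by blast
  qed
  have "bij f"
    using gf fg by (metis bijI')
  then have "with_center_axis Z l f"
    using img f unfolding with_center_axis_def collineation_def
    by (metis dilation_graph_def mates_def)
  \<comment> \<open>\<open>A\<close> lies on \<open>ZA\<close>, so its image is defined through
    \<open>B\<close>; symmetry of the link between the two pairs makes it \<open>A'\<close>.\<close>
  moreover have "dilation_graph Z l A A' B B' A A'"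
    using fr ex_line linked_swap unfolding dilation_graph_def dilation_frame_def collinear_def by metis
  then have "f A = A'"
    using f graph_ex1[OF fr] by metis
  ultimately show ?thesis by blast
qed

end

section \<open>Projective mappings and projectivities\<close>

context incidence_plane
begin

lemma points_on_eq_iff: "points_on inc a = points_on inc b \<longleftrightarrow> a = b"
proof
  assume "points_on inc a = points_on inc b"
  then have "inc X a \<longleftrightarrow> inc X b" for X
    unfolding points_on_def by blast
  then show "a = b"
    using three_points[of a] line_unique by auto
qed simp

section \<open>Collineations and the group of projective mappings\<close>

lemma collineation_image_iff:
  assumes "collineation inc f" "f ` points_on inc l = points_on inc m"
  shows "inc (f P) m \<longleftrightarrow> inc P l"
proof -
  have "inj f"
    using assms(1) bij_is_inj unfolding collineation_def by blast
  then have "f P \<in> f ` points_on inc l \<longleftrightarrow> P \<in> points_on inc l"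
    by (rule inj_image_mem_iff)
  then show ?thesis
    unfolding assms(2) by (simp add: points_on_def)
qed

lemma collineation_line:
  assumes f: "collineation inc f"
  shows "\<exists>m. \<forall>P. inc (f P) m \<longleftrightarrow> inc P l"
proof -
  obtain m where "f ` points_on inc l = points_on inc m"
    using f unfolding collineation_def by blast
  then show ?thesis
    using collineation_image_iff[OF f] by blast
qed

text \<open>By definition only images of lines are lines. For preimages, take two points of
  \<open>m\<close>: the line joining their preimages has an image through both points, which is
  therefore \<open>m\<close>.\<close>

lemma collineation_line_vimage:
  assumes f: "collineation inc f"
  shows "\<exists>l. \<forall>P. inc (f P) m \<longleftrightarrow> inc P l"
proof -
  obtain X Y where XY: "inc X m" "inc Y m" "X \<noteq> Y"
    using ex_point_on by metis
  obtain A B where AB: "X = f A" "Y = f B"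
    using f unfolding collineation_def by (metis bij_pointE)
  obtain l where l: "inc A l" "inc B l"
    using ex_line by blast
  obtain m' where "\<forall>P. inc (f P) m' \<longleftrightarrow> inc P l"
    using collineation_line[OF f] by blast
  moreover from this have "m' = m"
    using XY AB l line_unique by metis
  ultimately show ?thesis by blast
qed

lemma collineation_collinear:
  assumes f: "collineation inc f"
  shows "collinear inc (f A) (f B) (f C) \<longleftrightarrow> collinear inc A B C"
proof
  assume "collinear inc (f A) (f B) (f C)"
  then obtain m where "inc (f A) m" "inc (f B) m" "inc (f C) m"
    unfolding collinear_def by blast
  then show "collinear inc A B C"
    using collineation_line_vimage[OF f, of m] unfolding collinear_def by blast
next
  assume "collinear inc A B C"
  then obtain l where "inc A l" "inc B l" "inc C l"
    unfolding collinear_def by blast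
  then show "collinear inc (f A) (f B) (f C)"
    using collineation_line[OF f, of l] unfolding collinear_def by blast
qed

lemma collineation_eq_iff: "collineation inc f \<Longrightarrow> f A = f B \<longleftrightarrow> A = B"
  unfolding collineation_def by (metis bij_is_inj inj_eq)

lemma collineation_id: "collineation inc id"
  unfolding collineation_def by auto

lemma collineation_comp:
  assumes "collineation inc f" "collineation inc g"
  shows "collineation inc (g \<circ> f)"
proof -
  have "\<exists>n. (g \<circ> f) ` points_on inc l = points_on inc n" for l
    using assms unfolding collineation_def by (metis image_comp)
  moreover have "bij (g \<circ> f)"
    using assms by (simp add: collineation_def bij_comp)
  ultimately show ?thesis
    unfolding collineation_def by simp
qed

lemma collineation_inv:
  assumes f: "collineation inc f"
  shows "collineation inc (inv f)"
proof -
  have b: "bij f"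
    using f unfolding collineation_def by blast
  have "\<exists>l. inv f ` points_on inc m = points_on inc l" for m
  proof -
    obtain l where l: "\<forall>P. inc (f P) m \<longleftrightarrow> inc P l"
      using collineation_line_vimage[OF f] by blast
    have "inv f ` points_on inc m = f -` points_on inc m"
      using b by (simp add: bij_vimage_eq_inv_image)
    also have "\<dots> = points_on inc l"
      using l unfolding points_on_def by auto
    finally show ?thesis by blast
  qed
  then show ?thesis
    using b bij_imp_bij_inv unfolding collineation_def by blast
qed

lemma central_axial_id: "central_axial_collineation inc id"
  unfolding central_axial_collineation_def central_def axial_def using collineation_id by auto

lemma central_axial_inv:
  assumes f: "central_axial_collineation inc f"
  shows "central_axial_collineation inc (inv f)"
proof -
  have c: "collineation inc f" and b: "bij f"
    using f unfolding central_axial_collineation_def collineation_def by blast+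
  obtain Z where Z: "\<And>l. inc Z l \<Longrightarrow> f ` points_on inc l = points_on inc l"
    using f unfolding central_axial_collineation_def central_def by blast
  obtain l where l: "\<And>P. inc P l \<Longrightarrow> f P = P"
    using f unfolding central_axial_collineation_def axial_def by blast
  have "inv f ` points_on inc k = points_on inc k" if "inc Z k" for k
    using Z[OF that] b by (metis bij_is_inj image_inv_f_f)
  moreover have "inv f P = P" if "inc P l" for P
    using l[OF that] b by (metis bij_inv_eq_iff)
  ultimately show ?thesis
    using collineation_inv[OF c]
    unfolding central_axial_collineation_def central_def axial_def by blast
qed

lemma projective_mapping_id: "projective_mapping inc id"
  using central_axial_id by (rule projective_mapping.single)

lemma projective_mapping_collineation: "projective_mapping inc f \<Longrightarrow> collineation inc f"
proof (induction rule: projective_mapping.induct)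
  case (single f)
  then show ?case
    unfolding central_axial_collineation_def by blast
next
  case (comp f g)
  then have "collineation inc g"
    unfolding central_axial_collineation_def by blast
  then show ?case
    by (rule collineation_comp[OF comp.IH])
qed

lemma projective_mapping_comp:
  assumes "projective_mapping inc g" "projective_mapping inc f"
  shows "projective_mapping inc (g \<circ> f)"
  using assms
proof (induction rule: projective_mapping.induct)
  case (single g)
  then show ?case by (rule projective_mapping.comp[rotated])
next
  case (comp g h)
  then show ?case
    using projective_mapping.comp[of inc "g \<circ> f" h] by (simp only: comp_assoc)
qed

lemma projective_mapping_inv:
  assumes "projective_mapping inc f"
  shows "projective_mapping inc (inv f)"
  using assms
proof (induction rule: projective_mapping.induct)
  case (single f)
  then show ?case by (simp add: projective_mapping.single central_axial_inv)
next
  case (comp f g)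
  have "bij f" "bij g"
    using comp projective_mapping_collineation
    unfolding central_axial_collineation_def collineation_def by blast+
  then have "inv (g \<circ> f) = inv f \<circ> inv g"
    by (simp add: o_inv_distrib)
  then show ?case
    using comp projective_mapping_comp projective_mapping.single central_axial_inv by metis
qed

text \<open>\<open>Z\<close> is the only common point of two invariant lines.\<close>

lemma center_fixed:
  assumes "\<And>k. inc Z k \<Longrightarrow> f ` points_on inc k = points_on inc k"
  shows "f Z = Z"
proof -
  have on: "inc (f Z) k" if "inc Z k" for k
    using assms[OF that] that unfolding points_on_def by blast
  obtain k where k: "inc Z k"
    using ex_line by blast
  obtain k' where k': "inc Z k'" "k' \<noteq> k"
    using ex_line_through by blast
  then show ?thesis
    using on[OF k] on[OF k'(1)] k point_unique by metis
qed

lemma fixed_line: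
  assumes f: "collineation inc f" and fix2: "f P = P" "f Q = Q" "P \<noteq> Q" "inc P a" "inc Q a"
  shows "inc (f X) a \<longleftrightarrow> inc X a"
proof -
  obtain m where m: "\<forall>P. inc (f P) m \<longleftrightarrow> inc P a"
    using collineation_line[OF f] by blast
  then have "m = a"
    using fix2 line_unique by metis
  then show ?thesis using m by blast
qed

lemma fixed_meet:
  assumes f: "collineation inc f" and "f P = P" "f Q = Q" "P \<noteq> Q" "inc P a" "inc Q a"
    and "f R = R" "f S = S" "R \<noteq> S" "inc R b" "inc S b"
    and "a \<noteq> b" "inc X a" "inc X b"
  shows "f X = X"
proof -
  have "inc (f X) a" "inc (f X) b"
    using assms fixed_line[of f P Q a X] fixed_line[of f R S b X] by auto
  then show ?thesis
    using assms point_unique by metis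
qed

section \<open>Perspectivities, and projectivities as restrictions of projective mappings\<close>

lemma perspectivityI:
  assumes O: "\<not> inc V a" "\<not> inc V b"
    and g: "\<And>Q. inc Q a \<Longrightarrow> inc (g Q) b \<and> collinear inc V Q (g Q)"
  shows "perspectivity inc a b (restrict g (points_on inc a))"
proof -
  have "meet inc (join inc V Q) b = g Q" if Q: "inc Q a" for Q
  proof -
    obtain l where l: "inc V l" "inc Q l" "inc (g Q) l"
      using g[OF Q] unfolding collinear_def by blast
    then have "join inc V Q = l"
      using join_eq Q O by metis
    then show ?thesis
      using meet_eq l g[OF Q] O by metis
  qed
  then show ?thesis
    using O unfolding perspectivity_def points_on_def by (metis (no_types, lifting) mem_Collect_eq restrict_ext)
qed

text \<open>With \<open>perspectivityI\<close>, this replaces \<open>join\<close> and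
  \<open>meet\<close> by collinearity with the center in everything that follows.\<close>

lemma perspectivityE:
  assumes "perspectivity inc a b f"
  obtains V where "\<not> inc V a" "\<not> inc V b" "f \<in> extensional (points_on inc a)"
    "\<And>Q. inc Q a \<Longrightarrow> inc (f Q) b \<and> collinear inc V Q (f Q)"
proof -
  obtain V where V: "\<not> inc V a" "\<not> inc V b"
    and f: "f = restrict (\<lambda>Q. meet inc (join inc V Q) b) (points_on inc a)"
    using assms unfolding perspectivity_def by blast
  have "inc (f Q) b \<and> collinear inc V Q (f Q)" if Q: "inc Q a" for Q
  proof -
    obtain l where l: "inc V l" "inc Q l"
      using ex_line by blast
    obtain X where X: "inc X l" "inc X b"
      using ex_point by blast
    have "join inc V Q = l"
      using join_eq l Q V by metis
    moreover have "meet inc l b = X"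
      using meet_eq X l V by metis
    ultimately have "f Q = X"
      using Q unfolding f points_on_def by simp
    then show ?thesis
      using X l unfolding collinear_def by blast
  qed
  then show thesis
    using that V f by simp
qed

lemma projectivity_funcset: "projectivity inc a b f \<Longrightarrow> f \<in> points_on inc a \<rightarrow> points_on inc b"
proof (induction rule: projectivity.induct)
  case (single a b f)
  then show ?case
    by (auto simp: points_on_def elim: perspectivityE)
next
  case (comp a b f c g)
  have "g \<in> points_on inc b \<rightarrow> points_on inc c"
    using comp.hyps(2) by (auto simp: points_on_def elim: perspectivityE)
  then show ?case
    using comp.IH by (auto simp: compose_def)
qed

lemma projectivity_trans:
  assumes "projectivity inc b c g" "projectivity inc a b f"
  shows "projectivity inc a c (compose (points_on inc a) g f)"
  using assms
proof (induction rule: projectivity.induct)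
  case (single b c g)
  then show ?case by (simp add: projectivity.comp)
next
  case (comp b c g d h)
  then have "projectivity inc a d (compose (points_on inc a) h (compose (points_on inc a) g f))"
    by (simp add: projectivity.comp)
  then show ?case
    using compose_assoc[OF projectivity_funcset[OF comp.prems], of h g] by simp
qed

text \<open>
  On a line \<open>a\<close> through the center the map is not a perspectivity from the center.  There it is
  conjugated by a perspectivity from \<open>a\<close> to a line \<open>c\<close> that misses the center: a perspectivity with
  center \<open>V\<close> is carried by \<open>f\<close> to one with center \<open>f V\<close>.
\<close>

lemma central_collineation_projectivity:
  assumes f: "collineation inc f"
    and Z: "\<And>k. inc Z k \<Longrightarrow> f ` points_on inc k = points_on inc k"
    and ab: "f ` points_on inc a = points_on inc b"
  shows "projectivity inc a b (restrict f (points_on inc a))"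
proof -
  have fZ: "f Z = Z"
    using center_fixed Z by blast
  have on_ray: "collinear inc Z X (f X)" for X
    using ex_line[of Z X] Z unfolding collinear_def points_on_def by blast
  have persp: "perspectivity inc c d (restrict f (points_on inc c))"
    if c: "\<not> inc Z c" and cd: "f ` points_on inc c = points_on inc d" for c d
  proof (rule perspectivityI[OF c])
    note mem = collineation_image_iff[OF f cd]
    then show "\<not> inc Z d"
      using c fZ by metis
    show "inc (f Q) d \<and> collinear inc Z Q (f Q)" if "inc Q c" for Q
      using mem that on_ray by blast
  qed
  show ?thesis
  proof (cases "inc Z a")
    case False
    then show ?thesis
      using persp ab projectivity.single by metis
  next
    case True
    then have "b = a"
      using Z ab points_on_eq_iff by metis
    obtain c where c: "\<not> inc Z c"
      using ex_line_off by blast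
    obtain d where d: "f ` points_on inc c = points_on inc d"
      using f unfolding collineation_def by blast
    obtain V where V: "\<not> inc V a" "\<not> inc V c"
      using ex_point_off_two by blast
    note mem_a = collineation_image_iff[OF f Z[OF True]]
    note mem_d = collineation_image_iff[OF f d]
    have "\<forall>Q. \<exists>R. inc R c \<and> collinear inc V Q R" "\<forall>Q. \<exists>R. inc R a \<and> collinear inc (f V) Q R"
      using ex_line ex_point unfolding collinear_def by metis+
    then obtain p q where p: "\<And>Q. inc (p Q) c \<and> collinear inc V Q (p Q)"
      and q: "\<And>Q. inc (q Q) a \<and> collinear inc (f V) Q (q Q)"
      by metis
    let ?A = "points_on inc a"
    have p': "perspectivity inc a c (restrict p ?A)"
      using perspectivityI V p by blast
    have q': "perspectivity inc d a (restrict q (points_on inc d))"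
      using perspectivityI V q mem_a mem_d by blast
    \<comment> \<open>\<open>V\<close>, \<open>Q\<close>, \<open>p Q\<close> are collinear, hence so
      are their images. As \<open>f Q\<close> is on \<open>a\<close>, projecting
      \<open>f (p Q)\<close> from \<open>f V\<close> to \<open>a\<close> gives
      \<open>f Q\<close>.\<close>
    have "q (f (p Q)) = f Q" if Q: "inc Q a" for Q
    proof -
      have ne: "f V \<noteq> f (p Q)" "\<not> inc (f V) a"
        using mem_d mem_a V p by metis+
      obtain l where l: "inc (f V) l" "inc (f (p Q)) l" "inc (f Q) l"
        using p collineation_collinear[OF f, of V Q "p Q"] unfolding collinear_def by blast
      then have "inc (q (f (p Q))) l"
        using q collinear_iff ne by metis
      then show ?thesis
        using point_unique[of l a] l ne q mem_a Q by metis
    qed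
    then have "compose ?A (restrict q (points_on inc d))
        (compose ?A (restrict f (points_on inc c)) (restrict p ?A)) = restrict f ?A"
      using p mem_d unfolding compose_def points_on_def by (auto simp: fun_eq_iff)
    then show ?thesis
      using projectivity.comp[OF projectivity.comp[OF projectivity.single[OF p'] persp[OF c d]] q']
        \<open>b = a\<close> by simp
  qed
qed

lemma central_axial_projectivity:
  assumes "central_axial_collineation inc f" "f ` points_on inc a = points_on inc b"
  shows "projectivity inc a b (restrict f (points_on inc a))"
proof -
  obtain Z where "\<And>k. inc Z k \<Longrightarrow> f ` points_on inc k = points_on inc k"
    using assms(1) unfolding central_axial_collineation_def central_def by blast
  then show ?thesis
    using central_collineation_projectivity assms unfolding central_axial_collineation_def by blast
qed

lemma projective_mapping_projectivity:
  assumes "projective_mapping inc f" "f ` points_on inc a = points_on inc b"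
  shows "projectivity inc a b (restrict f (points_on inc a))"
  using assms
proof (induction arbitrary: b rule: projective_mapping.induct)
  case (single f)
  then show ?case by (rule central_axial_projectivity)
next
  case (comp f g)
  obtain c where c: "f ` points_on inc a = points_on inc c"
    using projective_mapping_collineation[OF comp.hyps(1)] unfolding collineation_def by blast
  then have "g ` points_on inc c = points_on inc b"
    using comp.prems by (metis image_comp)
  then have "projectivity inc c b (restrict g (points_on inc c))"
    by (rule central_axial_projectivity[OF comp.hyps(2)])
  then have "projectivity inc a b
      (compose (points_on inc a) (restrict g (points_on inc c)) (restrict f (points_on inc a)))"
    using projectivity_trans comp.IH[OF c] by blast
  moreover have "compose (points_on inc a) (restrict g (points_on inc c)) (restrict f (points_on inc a))
      = restrict (g \<circ> f) (points_on inc a)"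
    using c by (auto simp: fun_eq_iff compose_def)
  ultimately show ?case by (simp only:)
qed

section \<open>Uniqueness of projective mappings from the theorem on projectivities\<close>

definition FT_projectivities :: bool where
  "FT_projectivities \<longleftrightarrow> (\<forall>a b \<phi> \<psi>. projectivity inc a b \<phi> \<and> projectivity inc a b \<psi> \<and>
        (\<exists>P Q R. distinct [P, Q, R] \<and> inc P a \<and> inc Q a \<and> inc R a \<and>
           \<phi> P = \<psi> P \<and> \<phi> Q = \<psi> Q \<and> \<phi> R = \<psi> R) \<longrightarrow> \<phi> = \<psi>)"

definition FT_collineations :: bool where
  "FT_collineations \<longleftrightarrow> (\<forall>A B C D A' B' C' D'.
        general_position inc A B C D \<and> general_position inc A' B' C' D' \<longrightarrow>
        (\<exists>!\<Phi>. projective_mapping inc \<Phi> \<and>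
           \<Phi> A = A' \<and> \<Phi> B = B' \<and> \<Phi> C = C' \<and> \<Phi> D = D'))"

text \<open>The restriction of \<open>f\<close> is compared with the identity of \<open>a\<close>, a
  projectivity because it is the restriction of the projective mapping \<open>id\<close>.\<close>

lemma FT_projectivities_fixes_line:
  assumes FT: FT_projectivities and f: "projective_mapping inc f"
    and PQR: "distinct [P, Q, R]" "inc P a" "inc Q a" "inc R a" "f P = P" "f Q = Q" "f R = R"
    and X: "inc X a"
  shows "f X = X"
proof -
  have c: "collineation inc f"
    using projective_mapping_collineation[OF f] .
  obtain b where b: "f ` points_on inc a = points_on inc b"
    using c unfolding collineation_def by blast
  have "inc P b" "inc Q b"
    using b PQR unfolding points_on_def by (metis imageI mem_Collect_eq)+
  then have "b = a"
    using PQR line_unique by auto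
  then have "projectivity inc a a (restrict f (points_on inc a))"
    using projective_mapping_projectivity[OF f] b by blast
  moreover have "projectivity inc a a (restrict id (points_on inc a))"
    using projective_mapping_projectivity[OF projective_mapping_id, of a a] by simp
  moreover have "restrict f (points_on inc a) Y = restrict id (points_on inc a) Y"
    if "Y \<in> {P, Q, R}" for Y
    using that PQR unfolding points_on_def by auto
  ultimately have "restrict f (points_on inc a) = restrict id (points_on inc a)"
    using FT PQR unfolding FT_projectivities_def by (meson insertCI)
  then show ?thesis
    using X unfolding points_on_def by (metis id_apply mem_Collect_eq restrict_apply')
qed

text \<open>The third fixed point on \<open>AB\<close> is its intersection \<open>E\<close> with the
  invariant line \<open>CD\<close>.\<close>

lemma FT_projectivities_fixes_side:
  assumes FT: FT_projectivities and f: "projective_mapping inc f"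
    and g: "general_position inc A B C D" and fix4: "f A = A" "f B = B" "f C = C" "f D = D"
    and X: "collinear inc A B X"
  shows "f X = X"
proof -
  obtain a b where a: "inc A a" "inc B a" and b: "inc C b" "inc D b"
    using ex_line by metis
  obtain E where E: "inc E a" "inc E b"
    using ex_point by blast
  have dist: "A \<noteq> B" "C \<noteq> D" "\<not> inc A b" "\<not> inc B b"
    using g b unfolding general_position_def collinear_def by auto
  have "f E = E"
    using fixed_meet[OF projective_mapping_collineation[OF f], of A B a C D b E] fix4 a b E dist
    by auto
  moreover have "distinct [A, B, E]"
    using dist E by auto
  moreover have "inc X a"
    using X a dist collinear_iff by metis
  ultimately show ?thesis
    using FT_projectivities_fixes_line[OF FT f] fix4 a E by metis
qed

text \<open>A point \<open>X\<close> off the sides of the triangle is the intersection of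
  \<open>BX\<close> and \<open>CX\<close>. Each of these lines is invariant, carrying a vertex and a
  second fixed point on the opposite side.\<close>

lemma FT_projectivities_fixes_all:
  assumes FT: FT_projectivities and f: "projective_mapping inc f"
    and g: "general_position inc A B C D" and fix4: "f A = A" "f B = B" "f C = C" "f D = D"
  shows "f = id"
proof
  fix X
  have "general_position inc A C B D" "general_position inc B C A D"
    using g unfolding general_position_def collinear_def by auto
  then have side: "f Y = Y"
    if "collinear inc A B Y \<or> collinear inc A C Y \<or> collinear inc B C Y" for Y
    using that FT_projectivities_fixes_side[OF FT f] g fix4 by metis
  have nABC: "\<not> collinear inc A B C"
    using g unfolding general_position_def by simp
  have "f X = X" if nX: "\<not> collinear inc A B X" "\<not> collinear inc A C X" "\<not> collinear inc B C X"
  proof -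
    obtain b c s t where lines: "inc B b" "inc X b" "inc C c" "inc X c"
        "inc A s" "inc C s" "inc A t" "inc B t"
      using ex_line by metis
    obtain Y W where YW: "inc Y b" "inc Y s" "inc W c" "inc W t"
      using ex_point by metis
    have "f Y = Y" "f W = W"
      using side lines YW unfolding collinear_def by blast+
    moreover have "B \<noteq> Y" "C \<noteq> W" "b \<noteq> c"
      using nABC nX lines YW unfolding collinear_def by blast+
    ultimately show ?thesis
      using fixed_meet[OF projective_mapping_collineation[OF f], of B Y b C W c X] fix4 lines YW
      by auto
  qed
  then show "f X = id X"
    using side by auto
qed

end

section \<open>Extension of projectivities, and the theorem on projectivities from that on
  collineations\<close>

context desarguesian_plane
begin

lemma with_center_axisD:
  assumes "with_center_axis Z l f"
  shows "central_axial_collineation inc f" "f Z = Z" "inc P l \<Longrightarrow> f P = P"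
proof -
  show "central_axial_collineation inc f"
    using assms unfolding with_center_axis_def central_axial_collineation_def central_def axial_def
    by blast
  show "f Z = Z"
    using assms center_fixed unfolding with_center_axis_def by blast
  show "inc P l \<Longrightarrow> f P = P"
    using assms unfolding with_center_axis_def by blast
qed

text \<open>Any point of the line \<open>AA'\<close> other than \<open>A\<close> and
  \<open>A'\<close> serves as center; the result may be an elation or a homology.\<close>

lemma ex_with_axis:
  assumes "\<not> inc A l" "\<not> inc A' l"
  shows "\<exists>f. central_axial_collineation inc f \<and> (\<forall>P. inc P l \<longrightarrow> f P = P) \<and> f A = A'"
proof -
  obtain m where m: "inc A m" "inc A' m"
    using ex_line by blast
  obtain Z where Z: "inc Z m" "Z \<noteq> A" "Z \<noteq> A'"
    using ex_point_on by blast
  have "collinear inc Z A A'"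
    using m Z unfolding collinear_def by blast
  then obtain f where f: "with_center_axis Z l f" "f A = A'"
    using ex_with_center_axis[of A Z A' l] Z assms by metis
  then show ?thesis
    using with_center_axisD[OF f(1)] by blast
qed

text \<open>If \<open>a\<close> and \<open>b\<close> differ, the elation \<open>F\<close> with
  center \<open>V\<close> fixes their intersection \<open>R\<close> and takes \<open>A\<close> to
  \<open>f A\<close>, so it takes \<open>a\<close> to \<open>b\<close>. It preserves lines through
  \<open>V\<close> and hence agrees with \<open>f\<close> on \<open>a\<close>.\<close>

lemma perspectivity_extends:
  assumes "perspectivity inc a b f"
  shows "\<exists>F. central_axial_collineation inc F \<and> (\<forall>Q. inc Q a \<longrightarrow> f Q = F Q)"
proof -
  obtain V where V: "\<not> inc V a" "\<not> inc V b"
    and f: "\<And>Q. inc Q a \<Longrightarrow> inc (f Q) b \<and> collinear inc V Q (f Q)"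
    using perspectivityE[OF assms] by blast
  have f_eq: "f Q = X" if Q: "inc Q a" and X: "inc X b" "collinear inc V Q X" for Q X
  proof -
    obtain k where k: "inc V k" "inc Q k" "inc X k"
      using X(2) unfolding collinear_def by blast
    then have "inc (f Q) k"
      using f[OF Q] collinear_iff V Q by metis
    then show ?thesis
      using point_unique[of k b] k V f[OF Q] X by metis
  qed
  show ?thesis
  proof (cases "a = b")
    case True
    have "f Q = id Q" if "inc Q a" for Q
      using f_eq[OF that] True that ex_line unfolding collinear_def by (metis id_apply)
    then show ?thesis
      using central_axial_id by blast
  next
    case False
    obtain R where R: "inc R a" "inc R b"
      using ex_point by blast
    \<comment> \<open>Drawing the axis through the center \<open>V\<close> keeps \<open>A\<close>
      and \<open>f A\<close> off it, since neither \<open>a\<close> nor \<open>b\<close> passes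
      through \<open>V\<close>.\<close>
    obtain l where l: "inc V l" "inc R l"
      using ex_line by blast
    obtain A where A: "inc A a" "A \<noteq> R"
      using ex_point_on by blast
    have fA: "inc (f A) b" "collinear inc V A (f A)"
      using f A by blast+
    have nA: "\<not> inc A l"
      using A R l V line_unique by metis
    have "f A \<noteq> R"
    proof
      assume "f A = R"
      then have "inc A l"
        using fA(2) l V R collinear_iff collinear_swap by metis
      then show False
        using nA by blast
    qed
    then have "\<not> inc (f A) l"
      using fA R l V line_unique by metis
    then obtain F where F: "with_center_axis V l F" "F A = f A"
      using ex_with_center_axis[of A V "f A" l] fA nA V A by metis
    have c: "collineation inc F"
      using F(1) unfolding with_center_axis_def by blast
    have "F R = R"
      using with_center_axisD(3)[OF F(1)] l by blast
    obtain m where m: "\<forall>P. inc (F P) m \<longleftrightarrow> inc P a"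
      using collineation_line[OF c] by blast
    then have "inc R m" "inc (f A) m"
      using \<open>F R = R\<close> F(2) R A by metis+
    then have "m = b"
      using \<open>f A \<noteq> R\<close> fA R line_unique by metis
    have "f Q = F Q" if Q: "inc Q a" for Q
    proof -
      obtain k where k: "inc V k" "inc Q k"
        using ex_line by blast
      then have "inc (F Q) k"
        using F(1) unfolding with_center_axis_def points_on_def by blast
      then show ?thesis
        using f_eq[OF Q, of "F Q"] k m \<open>m = b\<close> Q unfolding collinear_def by blast
    qed
    then show ?thesis
      using with_center_axisD(1)[OF F(1)] by blast
  qed
qed

lemma projectivity_extends:
  assumes "projectivity inc a b f"
  shows "f \<in> extensional (points_on inc a) \<and>
    (\<exists>F. projective_mapping inc F \<and> (\<forall>Q. inc Q a \<longrightarrow> f Q = F Q))"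
  using assms
proof (induction rule: projectivity.induct)
  case (single a b f)
  then show ?case
    using perspectivity_extends projective_mapping.single perspectivityE by metis
next
  case (comp a b f c g)
  obtain F where F: "projective_mapping inc F" "\<And>Q. inc Q a \<Longrightarrow> f Q = F Q"
    using comp.IH by blast
  obtain G where G: "central_axial_collineation inc G" "\<And>Q. inc Q b \<Longrightarrow> g Q = G Q"
    using perspectivity_extends[OF comp.hyps(2)] by blast
  have "compose (points_on inc a) g f Q = (G \<circ> F) Q" if Q: "inc Q a" for Q
  proof -
    have "inc (f Q) b"
      using Q projectivity_funcset[OF comp.hyps(1)] unfolding points_on_def by auto
    then show ?thesis
      using Q F(2) G(2)[of "f Q"] unfolding compose_def points_on_def by simp
  qed
  then show ?case
    using projective_mapping.comp[OF F(1) G(1)] by auto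
qed

text \<open>Correcting \<open>X\<close> first gives a mapping that fixes \<open>R\<close> and
  \<open>X\<close>, so \<open>Y\<close> stays on the line \<open>c\<close> through them. Then
  \<open>X\<close> can be the center of the second correction, which brings \<open>Y\<close> back
  without moving \<open>X\<close> or the points of \<open>a\<close>.\<close>

lemma FT_collineations_fixes_line:
  assumes FT: FT_collineations and h: "projective_mapping inc h"
    and PQR: "distinct [P, Q, R]" "inc P a" "inc Q a" "inc R a" "h P = P" "h Q = Q" "h R = R"
    and W: "inc W a"
  shows "h W = W"
proof -
  have ch: "collineation inc h"
    using projective_mapping_collineation[OF h] .
  have a: "inc (h X) a \<longleftrightarrow> inc X a" for X
    using fixed_line[OF ch PQR(5,6) _ PQR(2,3)] PQR(1) by simp
  obtain c where c: "inc R c" "c \<noteq> a"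
    using ex_line_through by blast
  obtain X where X: "inc X c" "X \<noteq> R"
    using ex_point_on by blast
  obtain Y where Y: "inc Y c" "Y \<noteq> R" "Y \<noteq> X"
    using ex_point_on by blast
  have off: "\<not> inc X a" "\<not> inc Y a" "\<not> inc P c" "\<not> inc Q c"
    using c X Y PQR point_unique by auto
  obtain g1 where g1: "central_axial_collineation inc g1" "\<And>P. inc P a \<Longrightarrow> g1 P = P" "g1 (h X) = X"
    using ex_with_axis[of "h X" a X] off a by blast
  have c1: "collineation inc g1"
    using g1(1) unfolding central_axial_collineation_def by blast
  define k where "k = g1 \<circ> h"
  have k: "projective_mapping inc k" "k X = X" "\<And>Z. inc Z a \<Longrightarrow> k Z = h Z"
    using projective_mapping.comp[OF h g1(1)] g1 a by (auto simp: k_def)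
  have ck: "collineation inc k"
    using projective_mapping_collineation[OF k(1)] .
  have fix_k: "k P = P" "k Q = Q" "k R = R"
    using k(3) PQR by auto
  have "inc (k Y) c" "\<not> inc (k Y) a" "k Y \<noteq> X"
    using fixed_line[OF ck fix_k(3) k(2) _ c(1) X(1)] X Y off
      fixed_line[OF ck fix_k(1,2) _ PQR(2,3)] PQR(1) collineation_eq_iff[OF ck, of Y X] k(2)
    by auto
  moreover from this have "collinear inc X (k Y) Y"
    using X Y unfolding collinear_def by blast
  ultimately obtain g2 where g2: "with_center_axis X a g2" "g2 (k Y) = Y"
    using ex_with_center_axis[of "k Y" X Y a] Y off by metis
  note g2D = with_center_axisD[OF g2(1)]
  have "projective_mapping inc (g2 \<circ> k)"
    using projective_mapping.comp[OF k(1) g2D(1)] .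
  moreover have "(g2 \<circ> k) P = P" "(g2 \<circ> k) Q = Q" "(g2 \<circ> k) X = X" "(g2 \<circ> k) Y = Y"
    using fix_k k(2) g2 g2D PQR by auto
  moreover have "general_position inc P Q X Y"
  proof -
    have "P \<noteq> Q" "P \<noteq> X" "P \<noteq> Y" "Q \<noteq> X" "Q \<noteq> Y"
      using PQR X Y off by auto
    moreover from this have "\<not> collinear inc P Q X" "\<not> collinear inc P Q Y"
      using PQR off collinear_iff by metis+
    moreover have "\<not> collinear inc X Y P" "\<not> collinear inc X Y Q"
      using X Y off collinear_iff by metis+
    ultimately show ?thesis
      using Y collinear_rotate unfolding general_position_def by simp metis
  qed
  moreover have "id P = P" "id Q = Q" "id X = X" "id Y = Y"
    by simp_all
  ultimately have "g2 \<circ> k = id"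
    using FT projective_mapping_id unfolding FT_collineations_def by metis
  then have "g2 (k W) = W"
    by (metis comp_apply id_apply)
  then show ?thesis
    using g2D(3) k(3) W a by metis
qed

lemma FT_collineations_imp_FT_projectivities:
  assumes FT: FT_collineations
  shows FT_projectivities
  unfolding FT_projectivities_def
proof (intro allI impI, elim conjE exE)
  fix a b \<phi> \<psi> P Q R
  assume \<phi>: "projectivity inc a b \<phi>" and \<psi>: "projectivity inc a b \<psi>"
    and PQR: "distinct [P, Q, R]" "inc P a" "inc Q a" "inc R a" "\<phi> P = \<psi> P" "\<phi> Q = \<psi> Q" "\<phi> R = \<psi> R"
  obtain F where F: "projective_mapping inc F" "\<And>Q. inc Q a \<Longrightarrow> \<phi> Q = F Q"
    using projectivity_extends[OF \<phi>] by blast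
  obtain G where G: "projective_mapping inc G" "\<And>Q. inc Q a \<Longrightarrow> \<psi> Q = G Q"
    using projectivity_extends[OF \<psi>] by blast
  have bij: "bij G"
    using projective_mapping_collineation[OF G(1)] unfolding collineation_def by blast
  let ?h = "inv G \<circ> F"
  have h: "projective_mapping inc ?h"
    using projective_mapping_comp[OF projective_mapping_inv[OF G(1)] F(1)] .
  \<comment> \<open>Used from right to left at \<open>P\<close>, \<open>Q\<close>, \<open>R\<close>
    and from left to right at every point of \<open>a\<close>.\<close>
  have h_fix: "?h X = X \<longleftrightarrow> \<phi> X = \<psi> X" if "inc X a" for X
    using bij F(2)[OF that] G(2)[OF that] by (metis bij_inv_eq_iff comp_apply)
  have "?h P = P" "?h Q = Q" "?h R = R"
    using h_fix PQR by blast+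
  then have "\<phi> X = \<psi> X" if "inc X a" for X
    using FT_collineations_fixes_line[OF FT h PQR(1-4)] h_fix that by blast
  then show "\<phi> = \<psi>"
    using projectivity_extends[OF \<phi>] projectivity_extends[OF \<psi>]
    by (auto simp: points_on_def intro: extensionalityI)
qed

section \<open>Existence of projective mappings between quadruples, and the converse
  implication\<close>

text \<open>\<open>D\<close> moves to \<open>D'\<close> by way of the intersection \<open>E\<close>
  of \<open>AD\<close> and \<open>BD'\<close>: first with center \<open>A\<close> and axis
  \<open>BC\<close>, then with center \<open>B\<close> and axis \<open>AC\<close>. In both moves
  each of \<open>A\<close>, \<open>B\<close>, \<open>C\<close> is the center or lies on the
  axis.\<close>

lemma ex_projective_mapping_fourth_point:
  assumes g: "general_position inc A B C D" and g': "general_position inc A B C D'"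
  shows "\<exists>F. projective_mapping inc F \<and> F A = A \<and> F B = B \<and> F C = C \<and> F D = D'"
proof -
  obtain a b s t where a: "inc A a" "inc D a" and b: "inc B b" "inc D' b"
    and s: "inc B s" "inc C s" and t: "inc A t" "inc C t"
    using ex_line by metis
  obtain E where E: "inc E a" "inc E b"
    using ex_point by blast
  have ne: "D \<noteq> A" "D' \<noteq> B" "\<not> inc A b" "\<not> inc B a" "\<not> inc D s" "\<not> inc D' t" "\<not> inc C a" "\<not> inc C b"
    using g g' a b s t unfolding general_position_def collinear_def by auto
  have E_ne: "E \<noteq> A" "E \<noteq> B"
    using E ne by auto
  moreover have "\<not> inc E s"
    using E_ne E b s ne line_unique by metis
  moreover have "\<not> inc E t"
    using E_ne E a t ne line_unique by metis
  moreover have "collinear inc A D E" "collinear inc B E D'"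
    using a b E unfolding collinear_def by blast+
  ultimately obtain f h where f: "with_center_axis A s f" "f D = E" and h: "with_center_axis B t h" "h E = D'"
    using ex_with_center_axis[of D A E s] ex_with_center_axis[of E B D' t] ne by metis
  note fD = with_center_axisD[OF f(1)] and hD = with_center_axisD[OF h(1)]
  have "projective_mapping inc (h \<circ> f)"
    using projective_mapping.comp[OF projective_mapping.single[OF fD(1)] hD(1)] .
  then show ?thesis
    using f h fD hD s t by (metis comp_apply)
qed

text \<open>\<open>A\<close>, \<open>B\<close>, \<open>C\<close> are moved in turn, each time with
  an axis through the points already placed. No axis contains three noncollinear points, so the
  fourth move is left to \<open>ex_projective_mapping_fourth_point\<close>.\<close>

lemma ex_projective_mapping:
  assumes g: "general_position inc A B C D" and g': "general_position inc A' B' C' D'"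
  shows "\<exists>F. projective_mapping inc F \<and> F A = A' \<and> F B = B' \<and> F C = C' \<and> F D = D'"
proof -
  have image: "general_position inc (f A) (f B) (f C) (f D)" if "collineation inc f" for f
    using g collineation_collinear[OF that] collineation_eq_iff[OF that]
    unfolding general_position_def by simp
  have cac: "collineation inc f" if "central_axial_collineation inc f" for f
    using that unfolding central_axial_collineation_def by blast
  obtain l1 where "\<not> inc A l1" "\<not> inc A' l1"
    using ex_line_off_two by blast
  then obtain f1 where f1: "central_axial_collineation inc f1" "f1 A = A'"
    using ex_with_axis by blast
  have "A' \<noteq> f1 B" "A' \<noteq> B'"
    using image[OF cac[OF f1(1)]] f1 g' unfolding general_position_def by auto
  then obtain l2 where l2: "inc A' l2" "\<not> inc (f1 B) l2" "\<not> inc B' l2"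
    using ex_line_through_off_two by blast
  then obtain f2 where f2: "central_axial_collineation inc f2" "\<forall>P. inc P l2 \<longrightarrow> f2 P = P" "f2 (f1 B) = B'"
    using ex_with_axis by blast
  let ?F2 = "f2 \<circ> f1"
  have F2: "projective_mapping inc ?F2"
    using projective_mapping.comp[OF projective_mapping.single[OF f1(1)] f2(1)] .
  have "?F2 A = A'" "?F2 B = B'"
    using f1 f2 l2 by auto
  then have n2: "\<not> collinear inc A' B' (?F2 C)"
    using image[OF projective_mapping_collineation[OF F2]] unfolding general_position_def by simp
  obtain l3 where l3: "inc A' l3" "inc B' l3"
    using ex_line by blast
  then have "\<not> inc (?F2 C) l3" "\<not> inc C' l3"
    using n2 g' unfolding general_position_def collinear_def by blast+
  then obtain f3 where f3: "central_axial_collineation inc f3" "\<forall>P. inc P l3 \<longrightarrow> f3 P = P" "f3 (?F2 C) = C'"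
    using ex_with_axis by blast
  let ?F3 = "f3 \<circ> ?F2"
  have F3: "projective_mapping inc ?F3"
    using projective_mapping.comp[OF F2 f3(1)] .
  have F3_eq: "?F3 A = A'" "?F3 B = B'" "?F3 C = C'"
    using \<open>?F2 A = A'\<close> \<open>?F2 B = B'\<close> f3 l3 by auto
  then have "general_position inc A' B' C' (?F3 D)"
    using image[OF projective_mapping_collineation[OF F3]] by simp
  then obtain F4 where F4: "projective_mapping inc F4" "F4 A' = A'" "F4 B' = B'" "F4 C' = C'" "F4 (?F3 D) = D'"
    using ex_projective_mapping_fourth_point g' by blast
  have "projective_mapping inc (F4 \<circ> ?F3)"
    using projective_mapping_comp[OF F4(1) F3] .
  then show ?thesis
    using F3_eq F4 by (metis comp_apply)
qed

lemma FT_projectivities_imp_FT_collineations: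
  assumes FT: FT_projectivities
  shows FT_collineations
  unfolding FT_collineations_def
proof (intro allI impI, elim conjE)
  fix A B C D A' B' C' D'
  assume g: "general_position inc A B C D" and g': "general_position inc A' B' C' D'"
  have "F = G"
    if F: "projective_mapping inc F" "F A = A'" "F B = B'" "F C = C'" "F D = D'"
      and G: "projective_mapping inc G" "G A = A'" "G B = B'" "G C = C'" "G D = D'" for F G
  proof -
    have bij: "bij G"
      using projective_mapping_collineation[OF G(1)] unfolding collineation_def by blast
    have inv_G: "inv G (G X) = X" for X
      using bij by (simp add: bij_is_inj)
    have "projective_mapping inc (inv G \<circ> F)"
      using projective_mapping_comp[OF projective_mapping_inv[OF G(1)] F(1)] .
    moreover have "(inv G \<circ> F) A = A" "(inv G \<circ> F) B = B" "(inv G \<circ> F) C = C" "(inv G \<circ> F) D = D"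
      using inv_G[of A] inv_G[of B] inv_G[of C] inv_G[of D] F G by simp_all
    ultimately have "inv G \<circ> F = id"
      using FT_projectivities_fixes_all[OF FT _ g] by blast
    then show ?thesis
      using bij by (metis bij_is_surj comp_assoc comp_id id_comp surj_iff)
  qed
  then show "\<exists>!\<Phi>. projective_mapping inc \<Phi> \<and> \<Phi> A = A' \<and> \<Phi> B = B' \<and> \<Phi> C = C' \<and> \<Phi> D = D'"
    using ex_projective_mapping[OF g g'] by blast
qed

end

theorem mainTheorem4:
  fixes inc :: "'p \<Rightarrow> 'l \<Rightarrow> bool"
  assumes "desarguesian_plane inc"
  shows
    "(\<forall>a b \<phi> \<psi>. projectivity inc a b \<phi> \<and> projectivity inc a b \<psi> \<and>
        (\<exists>P Q R. distinct [P, Q, R] \<and> inc P a \<and> inc Q a \<and> inc R a \<and>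
           \<phi> P = \<psi> P \<and> \<phi> Q = \<psi> Q \<and> \<phi> R = \<psi> R) \<longrightarrow> \<phi> = \<psi>)
     \<longleftrightarrow>
     (\<forall>A B C D A' B' C' D'.
        general_position inc A B C D \<and> general_position inc A' B' C' D' \<longrightarrow>
        (\<exists>!\<Phi>. projective_mapping inc \<Phi> \<and>
           \<Phi> A = A' \<and> \<Phi> B = B' \<and> \<Phi> C = C' \<and> \<Phi> D = D'))"
proof -
  interpret desarguesian_plane inc
    by (rule assms)
  show ?thesis
    using FT_collineations_imp_FT_projectivities FT_projectivities_imp_FT_collineations
    unfolding FT_projectivities_def FT_collineations_def by (rule iffI[rotated])
qed

end
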